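(* Let $(A,\mu,\Delta=[-,r]_*,\alpha,r)$ be a coboundary $\epsilon$-Hom-bialgebra with $r$ anti-symmetric. Then the balanceator $B$ of $A$ is $0$.
   Context: Throughout, $\mathbf{k}$ is a fixed field of characteristic $0$; vector spaces, linear maps and tensor products are over $\mathbf{k}$. $\tau$ denotes the twist $\tau(x\otimes y)=y\otimes x$. A $2$-tensor $r$ is anti-symmetric if $\tau(r)=-r$. An $\epsilon$-Hom-bialgebra $(A,\mu,\Delta,\alpha)$ is a $\mathbf{k}$-vector space $A$ with linear maps $\mu\colon A^{\otimes 2}\to A$, $\Delta\colon A\to A^{\otimes 2}$, $\alpha\colon A\to A$ such that: $\alpha\circ\mu=\mu\circ\alpha^{\otimes 2}$; $\mu\circ(\alpha\otimes\mu)=\mu\circ(\mu\otimes\alpha)$; $\alpha^{\otimes 2}\circ\Delta=\Delta\circ\alpha$; $(\alpha\otimes\Delta)\circ\Delta=(\Delta\otimes\alpha)\circ\Delta$; and $\Delta\circ\mu=(\mu\otimes\alpha)\circ(\alpha\otimes\Delta)+(\alpha\otimes\mu)\circ(\Delta\otimes\alpha)$. For $a\in A$ and $r=\sum u_i\otimes v_i\in A^{\otimes 2}$, set $[a,r]_*=\sum\mu(a,u_i)\otimes\alpha(v_i)-\alpha(u_i)\otimes\mu(v_i,a)$. A coboundary $\epsilon$-Hom-bialgebra $(A,\mu,\Delta,\alpha,r)$ is an $\epsilon$-Hom-bialgebra $(A,\mu,\Delta,\alpha)$ together with an element $r\in A^{\otimes 2}$ with $\alpha^{\otimes 2}(r)=r$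 such that $\Delta=[-,r]_*$. For $a\in A$ and $b=\sum b_1\otimes b_2\in A^{\otimes 2}$, set $[a,b]_\bullet=\sum\mu(\alpha(a),b_1)\otimes\alpha(b_2)-\alpha(b_1)\otimes\mu(b_2,\alpha(a))$. With $\Delta^{op}=\tau\circ\Delta$, the balanceator of $A$ is the map $B\colon A^{\otimes 2}\to A^{\otimes 2}$ given by $$B(x,y)=[x,\Delta^{op}(y)]_\bullet+\tau([y,\Delta^{op}(x)]_\bullet).$$ *)

theory Defs
  imports "Jordan_Normal_Form.Missing_VectorSpace" "HOL-Algebra.AbelCoset"
begin

section \<open>Tensor products of vector spaces\<close>

(* Finitely supported functions on S. The ring multiplication of the record has no meaning for a
   vector space; it is filled in with zero, as in direct_sum. *)
definition free_space :: "('k, 'm) ring_scheme \<Rightarrow> 'x set \<Rightarrow> ('k, 'x \<Rightarrow> 'k) module"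
  where "free_space K S =
    \<lparr>carrier = {\<phi>. (\<forall>x. \<phi> x \<in> carrier K) \<and> (\<forall>x. x \<notin> S \<longrightarrow> \<phi> x = \<zero>\<^bsub>K\<^esub>) \<and> finite {x. \<phi> x \<noteq> \<zero>\<^bsub>K\<^esub>}},
     mult = (\<lambda>\<phi> \<psi> x. \<zero>\<^bsub>K\<^esub>),
     one = (\<lambda>x. \<zero>\<^bsub>K\<^esub>),
     zero = (\<lambda>x. \<zero>\<^bsub>K\<^esub>),
     add = (\<lambda>\<phi> \<psi> x. \<phi> x \<oplus>\<^bsub>K\<^esub> \<psi> x),
     smult = (\<lambda>c \<phi> x. c \<otimes>\<^bsub>K\<^esub> \<phi> x)\<rparr>"

definition free_gen :: "('k, 'm) ring_scheme \<Rightarrow> 'x \<Rightarrow> 'x \<Rightarrow> 'k"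
  where "free_gen K x = (\<lambda>y. if y = x then \<one>\<^bsub>K\<^esub> else \<zero>\<^bsub>K\<^esub>)"

definition quotient_space :: "('k, 'a, 'm) module_scheme \<Rightarrow> 'a set \<Rightarrow> ('k, 'a set) module"
  where "quotient_space V W =
    \<lparr>carrier = a_rcosets\<^bsub>V\<^esub> W,
     mult = (\<lambda>X Y. W),
     one = W,
     zero = W,
     add = (\<lambda>X Y. X <+>\<^bsub>V\<^esub> Y),
     smult = (\<lambda>c X. \<Union>x\<in>X. W +>\<^bsub>V\<^esub> (c \<odot>\<^bsub>V\<^esub> x))\<rparr>"

definition bilinear_relations ::
  "('k, 'm) ring_scheme \<Rightarrow> ('k, 'a, 'n) module_scheme \<Rightarrow> ('k, 'b, 'p) module_scheme \<Rightarrow> ('a \<times> 'b \<Rightarrow> 'k) set"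
  where "bilinear_relations K M N =
    (let F = free_space K (carrier M \<times> carrier N); e = (\<lambda>x y. free_gen K (x, y)) in
      {e (x \<oplus>\<^bsub>M\<^esub> x') y \<ominus>\<^bsub>F\<^esub> (e x y \<oplus>\<^bsub>F\<^esub> e x' y) | x x' y.
         x \<in> carrier M \<and> x' \<in> carrier M \<and> y \<in> carrier N} \<union>
      {e x (y \<oplus>\<^bsub>N\<^esub> y') \<ominus>\<^bsub>F\<^esub> (e x y \<oplus>\<^bsub>F\<^esub> e x y') | x y y'.
         x \<in> carrier M \<and> y \<in> carrier N \<and> y' \<in> carrier N} \<union>
      {e (c \<odot>\<^bsub>M\<^esub> x) y \<ominus>\<^bsub>F\<^esub> c \<odot>\<^bsub>F\<^esub> e x y | c x y.
         c \<in> carrier K \<and> x \<in> carrier M \<and> y \<in> carrier N} \<union>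
      {e x (c \<odot>\<^bsub>N\<^esub> y) \<ominus>\<^bsub>F\<^esub> c \<odot>\<^bsub>F\<^esub> e x y | c x y.
         c \<in> carrier K \<and> x \<in> carrier M \<and> y \<in> carrier N})"

definition tensor_null ::
  "('k, 'm) ring_scheme \<Rightarrow> ('k, 'a, 'n) module_scheme \<Rightarrow> ('k, 'b, 'p) module_scheme \<Rightarrow> ('a \<times> 'b \<Rightarrow> 'k) set"
  where "tensor_null K M N =
    module.span K (free_space K (carrier M \<times> carrier N)) (bilinear_relations K M N)"

definition tensor ::
  "('k, 'm) ring_scheme \<Rightarrow> ('k, 'a, 'n) module_scheme \<Rightarrow> ('k, 'b, 'p) module_scheme \<Rightarrow>
   ('k, ('a \<times> 'b \<Rightarrow> 'k) set) module"
  where "tensor K M N = quotient_space (free_space K (carrier M \<times> carrier N)) (tensor_null K M N)"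

definition pure_tensor ::
  "('k, 'm) ring_scheme \<Rightarrow> ('k, 'a, 'n) module_scheme \<Rightarrow> ('k, 'b, 'p) module_scheme \<Rightarrow>
   'a \<Rightarrow> 'b \<Rightarrow> ('a \<times> 'b \<Rightarrow> 'k) set"
  where "pure_tensor K M N x y =
    tensor_null K M N +>\<^bsub>free_space K (carrier M \<times> carrier N)\<^esub> free_gen K (x, y)"

(* The map on the tensor product of M and N sending the sum of the pure tensors of u_i and v_i to
   the sum of the f u_i v_i. It is independent of the representative chosen by SOME, and is the
   linear map induced by f, whenever f is bilinear on the carriers, as in all uses below. *)
definition tensor_lift ::
  "('k, 'm) ring_scheme \<Rightarrow> ('k, 'a, 'n) module_scheme \<Rightarrow> ('k, 'b, 'p) module_scheme \<Rightarrow>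
   ('k, 'c, 'q) module_scheme \<Rightarrow> ('a \<Rightarrow> 'b \<Rightarrow> 'c) \<Rightarrow> ('a \<times> 'b \<Rightarrow> 'k) set \<Rightarrow> 'c"
  where "tensor_lift K M N P f t =
    (let \<phi> = (SOME \<phi>. \<phi> \<in> t) in
      \<Oplus>\<^bsub>P\<^esub>p\<in>{p. \<phi> p \<noteq> \<zero>\<^bsub>K\<^esub>}. \<phi> p \<odot>\<^bsub>P\<^esub> f (fst p) (snd p))"

definition tensor_map ::
  "('k, 'm) ring_scheme \<Rightarrow> ('k, 'a, 'n) module_scheme \<Rightarrow> ('k, 'b, 'p) module_scheme \<Rightarrow>
   ('k, 'c, 'q) module_scheme \<Rightarrow> ('k, 'd, 's) module_scheme \<Rightarrow>
   ('a \<Rightarrow> 'c) \<Rightarrow> ('b \<Rightarrow> 'd) \<Rightarrow> ('a \<times> 'b \<Rightarrow> 'k) set \<Rightarrow> ('c \<times> 'd \<Rightarrow> 'k) set"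
  where "tensor_map K M N M' N' f g =
    tensor_lift K M N (tensor K M' N') (\<lambda>x y. pure_tensor K M' N' (f x) (g y))"

definition twist ::
  "('k, 'm) ring_scheme \<Rightarrow> ('k, 'a, 'n) module_scheme \<Rightarrow>
   ('a \<times> 'a \<Rightarrow> 'k) set \<Rightarrow> ('a \<times> 'a \<Rightarrow> 'k) set"
  where "twist K A = tensor_lift K A A (tensor K A A) (\<lambda>x y. pure_tensor K A A y x)"

(* The third tensor power occurs with both bracketings; assoc_right and assoc_left are the
   canonical mutually inverse isomorphisms between them. *)
definition assoc_right ::
  "('k, 'm) ring_scheme \<Rightarrow> ('k, 'a, 'n) module_scheme \<Rightarrow>
   (('a \<times> 'a \<Rightarrow> 'k) set \<times> 'a \<Rightarrow> 'k) set \<Rightarrow> ('a \<times> ('a \<times> 'a \<Rightarrow> 'k) set \<Rightarrow> 'k) set"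
  where "assoc_right K A =
    tensor_lift K (tensor K A A) A (tensor K A (tensor K A A))
      (\<lambda>s z. tensor_lift K A A (tensor K A (tensor K A A))
        (\<lambda>x y. pure_tensor K A (tensor K A A) x (pure_tensor K A A y z)) s)"

definition assoc_left ::
  "('k, 'm) ring_scheme \<Rightarrow> ('k, 'a, 'n) module_scheme \<Rightarrow>
   ('a \<times> ('a \<times> 'a \<Rightarrow> 'k) set \<Rightarrow> 'k) set \<Rightarrow> (('a \<times> 'a \<Rightarrow> 'k) set \<times> 'a \<Rightarrow> 'k) set"
  where "assoc_left K A =
    tensor_lift K A (tensor K A A) (tensor K (tensor K A A) A)
      (\<lambda>x s. tensor_lift K A A (tensor K (tensor K A A) A)
        (\<lambda>y z. pure_tensor K (tensor K A A) A (pure_tensor K A A x y) z) s)"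


section \<open>Infinitesimal Hom-bialgebras\<close>

locale eps_hom_bialgebra = vectorspace K A
  for K :: "('k, 'm) ring_scheme" and A :: "('k, 'a, 'n) module_scheme" +
  fixes \<mu> :: "('a \<times> 'a \<Rightarrow> 'k) set \<Rightarrow> 'a"
    and \<Delta> :: "'a \<Rightarrow> ('a \<times> 'a \<Rightarrow> 'k) set"
    and \<alpha> :: "'a \<Rightarrow> 'a"
  assumes mu_linear: "linear_map K (tensor K A A) A \<mu>"
    and Delta_linear: "linear_map K A (tensor K A A) \<Delta>"
    and alpha_linear: "linear_map K A A \<alpha>"
    and alpha_mu:
      "t \<in> carrier (tensor K A A) \<Longrightarrow> \<alpha> (\<mu> t) = \<mu> (tensor_map K A A A A \<alpha> \<alpha> t)"
    and hom_associative:
      "w \<in> carrier (tensor K (tensor K A A) A) \<Longrightarrow>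
        \<mu> (tensor_map K A (tensor K A A) A A \<alpha> \<mu> (assoc_right K A w)) =
        \<mu> (tensor_map K (tensor K A A) A A A \<mu> \<alpha> w)"
    and alpha_Delta:
      "a \<in> carrier A \<Longrightarrow> tensor_map K A A A A \<alpha> \<alpha> (\<Delta> a) = \<Delta> (\<alpha> a)"
    and hom_coassociative:
      "a \<in> carrier A \<Longrightarrow>
        tensor_map K A A A (tensor K A A) \<alpha> \<Delta> (\<Delta> a) =
        assoc_right K A (tensor_map K A A (tensor K A A) A \<Delta> \<alpha> (\<Delta> a))"
    and Delta_mu:
      "t \<in> carrier (tensor K A A) \<Longrightarrow>
        \<Delta> (\<mu> t) =
          tensor_map K (tensor K A A) A A A \<mu> \<alpha>
            (assoc_left K A (tensor_map K A A A (tensor K A A) \<alpha> \<Delta> t)) \<oplus>\<^bsub>tensor K A A\<^esub>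
          tensor_map K A (tensor K A A) A A \<alpha> \<mu>
            (assoc_right K A (tensor_map K A A (tensor K A A) A \<Delta> \<alpha> t))"

(* written [a,r]_* ; for [a,b]_\<bullet> below, a is moreover replaced by \<alpha>(a) *)
definition star_bracket ::
  "('k, 'm) ring_scheme \<Rightarrow> ('k, 'a, 'n) module_scheme \<Rightarrow> (('a \<times> 'a \<Rightarrow> 'k) set \<Rightarrow> 'a) \<Rightarrow> ('a \<Rightarrow> 'a) \<Rightarrow>
   'a \<Rightarrow> ('a \<times> 'a \<Rightarrow> 'k) set \<Rightarrow> ('a \<times> 'a \<Rightarrow> 'k) set"
  where "star_bracket K A \<mu> \<alpha> a =
    tensor_lift K A A (tensor K A A)
      (\<lambda>u v. pure_tensor K A A (\<mu> (pure_tensor K A A a u)) (\<alpha> v) \<ominus>\<^bsub>tensor K A A\<^esub>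
             pure_tensor K A A (\<alpha> u) (\<mu> (pure_tensor K A A v a)))"

locale coboundary_eps_hom_bialgebra = eps_hom_bialgebra K A \<mu> \<Delta> \<alpha>
  for K :: "('k, 'm) ring_scheme" and A :: "('k, 'a, 'n) module_scheme" and \<mu> \<Delta> \<alpha> +
  fixes r :: "('a \<times> 'a \<Rightarrow> 'k) set"
  assumes r_closed: "r \<in> carrier (tensor K A A)"
    and alpha_r: "tensor_map K A A A A \<alpha> \<alpha> r = r"
    and Delta_coboundary: "a \<in> carrier A \<Longrightarrow> \<Delta> a = star_bracket K A \<mu> \<alpha> a r"

definition antisymmetric ::
  "('k, 'm) ring_scheme \<Rightarrow> ('k, 'a, 'n) module_scheme \<Rightarrow> ('a \<times> 'a \<Rightarrow> 'k) set \<Rightarrow> bool"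
  where "antisymmetric K A r \<longleftrightarrow> twist K A r = \<ominus>\<^bsub>tensor K A A\<^esub> r"

definition bullet_bracket ::
  "('k, 'm) ring_scheme \<Rightarrow> ('k, 'a, 'n) module_scheme \<Rightarrow> (('a \<times> 'a \<Rightarrow> 'k) set \<Rightarrow> 'a) \<Rightarrow> ('a \<Rightarrow> 'a) \<Rightarrow>
   'a \<Rightarrow> ('a \<times> 'a \<Rightarrow> 'k) set \<Rightarrow> ('a \<times> 'a \<Rightarrow> 'k) set"
  where "bullet_bracket K A \<mu> \<alpha> a =
    tensor_lift K A A (tensor K A A)
      (\<lambda>b1 b2. pure_tensor K A A (\<mu> (pure_tensor K A A (\<alpha> a) b1)) (\<alpha> b2) \<ominus>\<^bsub>tensor K A A\<^esub>
               pure_tensor K A A (\<alpha> b1) (\<mu> (pure_tensor K A A b2 (\<alpha> a))))"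

(* B(x,y) is bilinear in x and y; the balanceator is the linear map on the tensor square that it
   induces. *)
definition balanceator ::
  "('k, 'm) ring_scheme \<Rightarrow> ('k, 'a, 'n) module_scheme \<Rightarrow> (('a \<times> 'a \<Rightarrow> 'k) set \<Rightarrow> 'a) \<Rightarrow>
   ('a \<Rightarrow> ('a \<times> 'a \<Rightarrow> 'k) set) \<Rightarrow> ('a \<Rightarrow> 'a) \<Rightarrow> ('a \<times> 'a \<Rightarrow> 'k) set \<Rightarrow> ('a \<times> 'a \<Rightarrow> 'k) set"
  where "balanceator K A \<mu> \<Delta> \<alpha> =
    tensor_lift K A A (tensor K A A)
      (\<lambda>x y. bullet_bracket K A \<mu> \<alpha> x (twist K A (\<Delta> y)) \<oplus>\<^bsub>tensor K A A\<^esub>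
             twist K A (bullet_bracket K A \<mu> \<alpha> y (twist K A (\<Delta> x))))"

end

theory Submission
  imports Defs
begin

text \<open>
  Compare, for an arbitrary 2-tensor \<open>s\<close>, the two elements \<open>[x, \<tau>[y, s]\<^sub>*]\<^sub>\<bullet>\<close> and
  \<open>\<tau>[y, \<tau>[x, \<tau> s]\<^sub>*]\<^sub>\<bullet>\<close>. Both depend linearly on \<open>s\<close>, and on a pure tensor they expand to the same
  four terms, by multiplicativity of \<open>\<alpha>\<close> and Hom-associativity; hence they are equal. For \<open>s = r\<close>
  anti-symmetry gives \<open>\<tau> r = - r\<close>, so the two summands of \<open>B(x, y)\<close> cancel.
\<close>

section \<open>Free modules\<close>

lemma free_space_simps [simp]:
  "\<zero>\<^bsub>free_space K S\<^esub> = (\<lambda>x. \<zero>\<^bsub>K\<^esub>)"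
  "\<phi> \<oplus>\<^bsub>free_space K S\<^esub> \<psi> = (\<lambda>x. \<phi> x \<oplus>\<^bsub>K\<^esub> \<psi> x)"
  "c \<odot>\<^bsub>free_space K S\<^esub> \<phi> = (\<lambda>x. c \<otimes>\<^bsub>K\<^esub> \<phi> x)"
  by (simp_all add: free_space_def)

lemma free_space_carrier:
  "\<phi> \<in> carrier (free_space K S) \<longleftrightarrow>
    (\<forall>x. \<phi> x \<in> carrier K) \<and> {x. \<phi> x \<noteq> \<zero>\<^bsub>K\<^esub>} \<subseteq> S \<and> finite {x. \<phi> x \<noteq> \<zero>\<^bsub>K\<^esub>}"
  by (auto simp: free_space_def)

lemma (in cring) module_free_space: "module R (free_space R S)"
proof (rule module_criteria, goal_cases)
  case 3
  have "(\<lambda>x. v x \<oplus> w x) \<in> carrier (free_space R S)"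
    if "v \<in> carrier (free_space R S)" "w \<in> carrier (free_space R S)" for v w
  proof -
    have "{x. v x \<oplus> w x \<noteq> \<zero>} \<subseteq> {x. v x \<noteq> \<zero>} \<union> {x. w x \<noteq> \<zero>}"
      by auto
    with that show ?thesis
      by (auto simp: free_space_carrier intro: finite_subset)
  qed
  then show ?case by auto
next
  case 4
  have "\<exists>w\<in>carrier (free_space R S). v \<oplus>\<^bsub>free_space R S\<^esub> w = \<zero>\<^bsub>free_space R S\<^esub>"
    if "v \<in> carrier (free_space R S)" for v
  proof (rule bexI)
    have "{x. \<ominus> v x \<noteq> \<zero>} \<subseteq> {x. v x \<noteq> \<zero>}"
      by auto
    with that show "(\<lambda>x. \<ominus> v x) \<in> carrier (free_space R S)"
      by (auto simp: free_space_carrier intro: finite_subset)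
  qed (use that in \<open>auto simp: free_space_carrier r_neg\<close>)
  then show ?case by auto
next
  case 5
  have "(\<lambda>x. c \<otimes> v x) \<in> carrier (free_space R S)"
    if "c \<in> carrier R" "v \<in> carrier (free_space R S)" for c v
  proof -
    have "{x. c \<otimes> v x \<noteq> \<zero>} \<subseteq> {x. v x \<noteq> \<zero>}"
      using that by auto
    with that show ?thesis
      by (auto simp: free_space_carrier intro: finite_subset)
  qed
  then show ?case by auto
qed (auto simp: free_space_carrier fun_eq_iff a_ac m_assoc l_distr r_distr cring_axioms)

lemma (in cring) free_gen_closed:
  "p \<in> S \<Longrightarrow> free_gen R p \<in> carrier (free_space R S)"
  by (auto simp: free_space_carrier free_gen_def intro: finite_subset[of _ "{p}"])

text \<open>Induction on the finite support: setting the value at one point \<open>p\<close> to zero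
  leaves a function whose support has one point fewer, and the removed part is a multiple of the
  generator at \<open>p\<close>.\<close>

lemma (in cring) free_space_induct [consumes 1, case_names zero add]:
  assumes "\<phi> \<in> carrier (free_space R S)"
    and zero: "P \<zero>\<^bsub>free_space R S\<^esub>"
    and add: "\<And>c p \<psi>. \<lbrakk>c \<in> carrier R; p \<in> S; \<psi> \<in> carrier (free_space R S); P \<psi>\<rbrakk> \<Longrightarrow>
      P (c \<odot>\<^bsub>free_space R S\<^esub> free_gen R p \<oplus>\<^bsub>free_space R S\<^esub> \<psi>)"
  shows "P \<phi>"
proof -
  have "P \<phi>" if "\<phi> \<in> carrier (free_space R S)" "{x. \<phi> x \<noteq> \<zero>} = T" "finite T" for T \<phi>
    using that(3,1,2)
  proof (induction T arbitrary: \<phi> rule: finite_induct)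
    case empty
    then have "\<phi> = (\<lambda>x. \<zero>)" by auto
    with zero show ?case by simp
  next
    case (insert p T)
    define \<psi> where "\<psi> = \<phi>(p := \<zero>)"
    have supp: "{x. \<psi> x \<noteq> \<zero>} = T"
      using insert.prems(2) insert.hyps(2) by (auto simp: \<psi>_def)
    have \<psi>: "\<psi> \<in> carrier (free_space R S)"
      using insert.prems insert.hyps(1) supp by (auto simp: free_space_carrier \<psi>_def)
    have "\<phi> = \<phi> p \<odot>\<^bsub>free_space R S\<^esub> free_gen R p \<oplus>\<^bsub>free_space R S\<^esub> \<psi>"
      using insert.prems(1) by (auto simp: free_space_carrier \<psi>_def free_gen_def)
    moreover have "p \<in> S" "\<phi> p \<in> carrier R"
      using insert.prems by (auto simp: free_space_carrier)
    ultimately show ?case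
      using add[OF _ _ \<psi> insert.IH[OF \<psi> supp]] by metis
  qed
  from this[OF assms(1) refl] show ?thesis
    using assms(1) by (simp add: free_space_carrier)
qed

text \<open>The linear extension of \<open>f\<close> from the generators to the free module. It is
  the sum inside \<open>tensor_lift\<close> with the representative as an explicit argument, so that
  it can be studied before any choice is made.\<close>

definition free_eval ::
  "('k, 'm) ring_scheme \<Rightarrow> ('k, 'c, 'q) module_scheme \<Rightarrow> ('x \<Rightarrow> 'c) \<Rightarrow> ('x \<Rightarrow> 'k) \<Rightarrow> 'c"
  where "free_eval K P f \<phi> = (\<Oplus>\<^bsub>P\<^esub>p\<in>{p. \<phi> p \<noteq> \<zero>\<^bsub>K\<^esub>}. \<phi> p \<odot>\<^bsub>P\<^esub> f p)"

context module
begin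

text \<open>Points outside the support contribute zero. Enlarging the index set makes it possible to
  compare functions with different supports termwise.\<close>

lemma free_eval_superset:
  assumes "\<phi> \<in> carrier (free_space R S)" "f \<in> S \<rightarrow> carrier M"
    and "finite T" "{p. \<phi> p \<noteq> \<zero>} \<subseteq> T" "T \<subseteq> S"
  shows "free_eval R M f \<phi> = (\<Oplus>\<^bsub>M\<^esub>p\<in>T. \<phi> p \<odot>\<^bsub>M\<^esub> f p)"
  unfolding free_eval_def
  using assms
  by (intro M.add.finprod_mono_neutral_cong_left) (auto simp: free_space_carrier Pi_iff subset_iff)

lemma free_eval_hom:
  assumes f: "f \<in> S \<rightarrow> carrier M"
  shows "free_eval R M f \<in> module_hom R (free_space R S) M"
proof -
  interpret F: module R "free_space R S"
    by (rule module_free_space)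
  have closed: "free_eval R M f \<phi> \<in> carrier M" if "\<phi> \<in> carrier (free_space R S)" for \<phi>
    unfolding free_eval_def using that f
    by (intro M.finsum_closed) (auto simp: free_space_carrier Pi_iff)
  have add: "free_eval R M f (\<phi> \<oplus>\<^bsub>free_space R S\<^esub> \<psi>) = free_eval R M f \<phi> \<oplus>\<^bsub>M\<^esub> free_eval R M f \<psi>"
    if \<phi>: "\<phi> \<in> carrier (free_space R S)" and \<psi>: "\<psi> \<in> carrier (free_space R S)" for \<phi> \<psi>
  proof -
    \<comment> \<open>Cancellation can make the support of the sum smaller than the union, so all
      three sums are taken over the union.\<close>
    let ?T = "{p. \<phi> p \<noteq> \<zero>} \<union> {p. \<psi> p \<noteq> \<zero>}"
    have T: "finite ?T" "?T \<subseteq> S"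
      using \<phi> \<psi> by (auto simp: free_space_carrier)
    have carr: "\<phi> p \<in> carrier R" "\<psi> p \<in> carrier R" for p
      using \<phi> \<psi> by (auto simp: free_space_carrier)
    have "free_eval R M f (\<phi> \<oplus>\<^bsub>free_space R S\<^esub> \<psi>)
        = (\<Oplus>\<^bsub>M\<^esub>p\<in>?T. (\<phi> \<oplus>\<^bsub>free_space R S\<^esub> \<psi>) p \<odot>\<^bsub>M\<^esub> f p)"
      by (rule free_eval_superset[OF F.a_closed[OF \<phi> \<psi>] f T(1) _ T(2)]) auto
    also have "\<dots> = (\<Oplus>\<^bsub>M\<^esub>p\<in>?T. \<phi> p \<odot>\<^bsub>M\<^esub> f p \<oplus>\<^bsub>M\<^esub> \<psi> p \<odot>\<^bsub>M\<^esub> f p)"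
      using carr f T by (intro M.add.finprod_cong') (auto simp: smult_l_distr Pi_iff subset_iff)
    also have "\<dots> = free_eval R M f \<phi> \<oplus>\<^bsub>M\<^esub> free_eval R M f \<psi>"
      using carr f T
      by (subst M.finsum_addf)
        (auto simp: free_eval_superset[OF \<phi> f T(1) _ T(2)] free_eval_superset[OF \<psi> f T(1) _ T(2)]
          Pi_iff subset_iff)
    finally show ?thesis .
  qed
  have smult: "free_eval R M f (c \<odot>\<^bsub>free_space R S\<^esub> \<phi>) = c \<odot>\<^bsub>M\<^esub> free_eval R M f \<phi>"
    if c: "c \<in> carrier R" and \<phi>: "\<phi> \<in> carrier (free_space R S)" for c \<phi>
  proof -
    let ?T = "{p. \<phi> p \<noteq> \<zero>}"
    have T: "finite ?T" "?T \<subseteq> S"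
      using \<phi> by (auto simp: free_space_carrier)
    have carr: "\<phi> p \<in> carrier R" for p
      using \<phi> by (auto simp: free_space_carrier)
    have "free_eval R M f (c \<odot>\<^bsub>free_space R S\<^esub> \<phi>)
        = (\<Oplus>\<^bsub>M\<^esub>p\<in>?T. (c \<odot>\<^bsub>free_space R S\<^esub> \<phi>) p \<odot>\<^bsub>M\<^esub> f p)"
      by (rule free_eval_superset[OF F.smult_closed[OF c \<phi>] f T(1) _ T(2)]) (auto simp: c)
    also have "\<dots> = (\<Oplus>\<^bsub>M\<^esub>p\<in>?T. c \<odot>\<^bsub>M\<^esub> (\<phi> p \<odot>\<^bsub>M\<^esub> f p))"
      using c carr f T by (intro M.add.finprod_cong') (auto simp: smult_assoc1 Pi_iff subset_iff)
    also have "\<dots> = c \<odot>\<^bsub>M\<^esub> free_eval R M f \<phi>"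
      unfolding free_eval_def using c carr f T
      by (subst finsum_smult) (auto simp: Pi_iff subset_iff)
    finally show ?thesis .
  qed
  show ?thesis
    unfolding module_hom_def using closed add smult by blast
qed

lemma free_eval_gen:
  assumes "p \<in> S" "f \<in> S \<rightarrow> carrier M"
  shows "free_eval R M f (free_gen R p) = f p"
proof -
  \<comment> \<open>The index set is \<open>{p}\<close> rather than the support, which would be
    empty if \<open>\<one>\<close> and \<open>\<zero>\<close> coincided in \<open>R\<close>.\<close>
  have "free_eval R M f (free_gen R p) = (\<Oplus>\<^bsub>M\<^esub>q\<in>{p}. free_gen R p q \<odot>\<^bsub>M\<^esub> f q)"
    by (rule free_eval_superset[OF free_gen_closed[OF assms(1)] assms(2)])
      (auto simp: free_gen_def assms(1))
  with assms show ?thesis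
    by (simp add: M.finsum_singleton free_gen_def Pi_iff)
qed

end

section \<open>Quotient modules\<close>

text \<open>Closure under negation comes from multiplication by \<open>\<ominus>\<one>\<close>. The
  result opens the theory of cosets in abelian groups to submodules.\<close>

lemma submodule_imp_abelian_subgroup:
  assumes "submodule R W V"
  shows "abelian_subgroup W V"
proof -
  interpret submodule R W V by fact
  interpret V: module R V by (rule module)
  have "\<ominus>\<^bsub>V\<^esub> v \<in> W" if "v \<in> W" for v
  proof -
    have "(\<ominus>\<^bsub>R\<^esub> \<one>\<^bsub>R\<^esub>) \<odot>\<^bsub>V\<^esub> v \<in> W"
      using that by (intro smult_closed) simp_all
    moreover have "v \<in> carrier V"
      using that subset by blast
    ultimately show ?thesis
      by (simp add: V.smult_minus_1)
  qed
  moreover have "W \<noteq> {}"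
    using zero_closed by blast
  ultimately have "subgroup W (add_monoid V)"
    by (intro V.add.subgroupI) (simp_all add: subset a_inv_def[symmetric])
  then show ?thesis
    by (intro abelian_subgroupI3 additive_subgroupI V.abelian_group_axioms)
qed

lemma quotient_space_simps:
  "carrier (quotient_space V W) = a_rcosets\<^bsub>V\<^esub> W"
  "\<zero>\<^bsub>quotient_space V W\<^esub> = W"
  "X \<oplus>\<^bsub>quotient_space V W\<^esub> Y = X <+>\<^bsub>V\<^esub> Y"
  "c \<odot>\<^bsub>quotient_space V W\<^esub> X = (\<Union>x\<in>X. W +>\<^bsub>V\<^esub> (c \<odot>\<^bsub>V\<^esub> x))"
  by (simp_all add: quotient_space_def)

context submodule
begin

lemma quotient_space_add:
  assumes "x \<in> carrier M" "y \<in> carrier M"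
  shows "(N +> x) \<oplus>\<^bsub>quotient_space M N\<^esub> (N +> y) = N +> (x \<oplus> y)"
proof -
  interpret W: abelian_subgroup N M
    by (rule submodule_imp_abelian_subgroup) (rule submodule_axioms)
  show ?thesis
    using assms by (simp add: quotient_space_simps W.a_rcos_sum)
qed

text \<open>Scalar multiplication is defined as a union of cosets, one for each \<open>y\<close> in
  \<open>N +> x\<close>. They all coincide, because \<open>c \<odot> y\<close> and
  \<open>c \<odot> x\<close> differ by \<open>c\<close> times an element of
  \<open>N\<close>.\<close>

lemma quotient_space_smult:
  assumes "c \<in> carrier R" "x \<in> carrier M"
  shows "c \<odot>\<^bsub>quotient_space M N\<^esub> (N +> x) = N +> (c \<odot> x)"
proof -
  interpret M: module R M by (rule module)
  interpret W: abelian_subgroup N M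
    by (rule submodule_imp_abelian_subgroup) (rule submodule_axioms)
  have "N +> (c \<odot> y) = N +> (c \<odot> x)" if y: "y \<in> N +> x" for y
  proof -
    have yc: "y \<in> carrier M"
      using W.a_elemrcos_carrier[OF assms(2) y] .
    have "c \<odot> (y \<oplus> \<ominus> x) \<in> N"
      using W.a_rcos_module_imp[OF assms(2) y] assms(1) by auto
    then have "c \<odot> y \<oplus> \<ominus> (c \<odot> x) \<in> N"
      using assms yc by (simp add: M.smult_r_distr M.smult_r_minus)
    then have "c \<odot> y \<in> N +> (c \<odot> x)"
      using assms yc by (intro W.a_rcos_module_rev) auto
    then show ?thesis
      using W.a_repr_independence' assms by blast
  qed
  \<comment> \<open>A union of equal sets is that set only when the index set is nonempty.\<close>
  moreover have "N +> x \<noteq> {}"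
    using W.a_rcos_self[OF assms(2)] by blast
  ultimately show ?thesis
    unfolding quotient_space_simps by (intro SUP_eq_const)
qed

lemma quotient_space_cases:
  assumes "X \<in> carrier (quotient_space M N)"
  obtains x where "x \<in> carrier M" "X = N +> x"
  using assms by (auto simp: quotient_space_simps A_RCOSETS_def')

lemma quotient_space_closed: "x \<in> carrier M \<Longrightarrow> N +> x \<in> carrier (quotient_space M N)"
  by (auto simp: quotient_space_simps A_RCOSETS_def')

lemma quotient_space_zero: "\<zero>\<^bsub>quotient_space M N\<^esub> = N +> \<zero>"
proof -
  interpret W: abelian_subgroup N M
    by (rule submodule_imp_abelian_subgroup) (rule submodule_axioms)
  show ?thesis
    by (simp add: quotient_space_simps W.a_rcos_const)
qed

text \<open>Every element has the form \<open>N +> x\<close> and the operations act on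
  representatives, so each axiom descends from \<open>M\<close>.\<close>

lemma module_quotient_space: "module R (quotient_space M N)"
proof -
  interpret M: module R M by (rule module)
  note simps = quotient_space_add quotient_space_smult quotient_space_zero quotient_space_closed
  have neg: "\<exists>Y\<in>carrier (quotient_space M N). (N +> x) \<oplus>\<^bsub>quotient_space M N\<^esub> Y = N +> \<zero>"
    if "x \<in> carrier M" for x
    using that by (intro bexI[of _ "N +> (\<ominus> x)"]) (simp_all add: simps M.r_neg)
  show ?thesis
    by (rule module_criteria; (intro allI ballI impI)?; (elim conjE)?; (elim quotient_space_cases)?)
      (simp_all add: simps neg M.a_ac M.smult_l_distr M.smult_r_distr M.smult_assoc1 M.R.is_cring)
qed

lemma quotient_map_hom: "(\<lambda>x. N +> x) \<in> module_hom R M (quotient_space M N)"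
  by (auto simp: module_hom_def quotient_space_add quotient_space_smult quotient_space_closed)

lemma coset_eqI:
  assumes "x \<in> carrier M" "y \<in> carrier M" "x \<ominus> y \<in> N"
  shows "N +> x = N +> y"
proof -
  interpret W: abelian_subgroup N M
    by (rule submodule_imp_abelian_subgroup) (rule submodule_axioms)
  have "x \<in> N +> y"
    using assms by (intro W.a_rcos_module_rev) (simp_all add: a_minus_def)
  then show ?thesis
    using W.a_repr_independence' assms(2) by metis
qed

end

section \<open>Linear and bilinear maps\<close>

text \<open>Passage from the set \<open>module_hom\<close>, in which the constructions below take
  place, to the locale \<open>mod_hom\<close>, which supplies kernels and the behaviour on zero,
  negatives and differences.\<close>

lemma mod_homI: "\<lbrakk>module K M; module K N; f \<in> module_hom K M N\<rbrakk> \<Longrightarrow> mod_hom K M N f"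
  by (simp add: mod_hom_def mod_hom_axioms_def)

lemma module_hom_mem: "\<lbrakk>f \<in> module_hom K M N; x \<in> carrier M\<rbrakk> \<Longrightarrow> f x \<in> carrier N"
  by (auto simp: module_hom_def)

lemma module_hom_comp:
  "\<lbrakk>g \<in> module_hom K N P; f \<in> module_hom K M N\<rbrakk> \<Longrightarrow> (\<lambda>x. g (f x)) \<in> module_hom K M P"
  by (auto simp: module_hom_def Pi_iff)

lemma module_hom_id: "(\<lambda>x. x) \<in> module_hom K M M"
  by (simp add: module_hom_def)

lemma module_hom_add_fun:
  assumes "module K P" "f \<in> module_hom K M P" "g \<in> module_hom K M P"
  shows "(\<lambda>x. f x \<oplus>\<^bsub>P\<^esub> g x) \<in> module_hom K M P"
proof -
  interpret P: module K P by fact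
  show ?thesis
    using assms(2,3) by (auto simp: module_hom_def Pi_iff P.M.a_ac P.smult_r_distr)
qed

lemma module_hom_smult_fun:
  assumes "module K P" "f \<in> module_hom K M P" "c \<in> carrier K"
  shows "(\<lambda>x. c \<odot>\<^bsub>P\<^esub> f x) \<in> module_hom K M P"
proof -
  interpret P: module K P by fact
  show ?thesis
    using assms(2,3)
    by (auto simp: module_hom_def Pi_iff P.smult_r_distr P.R.m_comm P.smult_assoc1[symmetric])
qed

lemma module_hom_minus_fun:
  assumes "module K P" "f \<in> module_hom K M P" "g \<in> module_hom K M P"
  shows "(\<lambda>x. f x \<ominus>\<^bsub>P\<^esub> g x) \<in> module_hom K M P"
proof -
  interpret P: module K P by fact
  show ?thesis
    using assms(2,3)
    by (auto simp: module_hom_def Pi_iff a_minus_def P.M.a_ac P.M.minus_add P.smult_r_distr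
        P.smult_r_minus)
qed

text \<open>Phrased through the partial maps, so that statements about linear maps apply directly in
  each variable.\<close>

definition bilinear_map ::
  "('k, 'm) ring_scheme \<Rightarrow> ('k, 'a, 'n) module_scheme \<Rightarrow> ('k, 'b, 'p) module_scheme \<Rightarrow>
   ('k, 'c, 'q) module_scheme \<Rightarrow> ('a \<Rightarrow> 'b \<Rightarrow> 'c) \<Rightarrow> bool"
  where "bilinear_map K M N P f \<longleftrightarrow>
    (\<forall>y\<in>carrier N. (\<lambda>x. f x y) \<in> module_hom K M P) \<and> (\<forall>x\<in>carrier M. f x \<in> module_hom K N P)"

lemma bilinear_map_left: "\<lbrakk>bilinear_map K M N P f; y \<in> carrier N\<rbrakk> \<Longrightarrow> (\<lambda>x. f x y) \<in> module_hom K M P"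
  and bilinear_map_right: "\<lbrakk>bilinear_map K M N P f; x \<in> carrier M\<rbrakk> \<Longrightarrow> f x \<in> module_hom K N P"
  by (simp_all add: bilinear_map_def)

lemma bilinear_map_closed:
  "\<lbrakk>bilinear_map K M N P f; x \<in> carrier M; y \<in> carrier N\<rbrakk> \<Longrightarrow> f x y \<in> carrier P"
  by (auto simp: bilinear_map_def intro: module_hom_mem)

lemma bilinear_map_comp:
  assumes "bilinear_map K M N P f" "g \<in> module_hom K M' M" "h \<in> module_hom K N' N"
  shows "bilinear_map K M' N' P (\<lambda>x y. f (g x) (h y))"
  unfolding bilinear_map_def
  using module_hom_comp[OF bilinear_map_left[OF assms(1) module_hom_mem[OF assms(3)]] assms(2)]
    module_hom_comp[OF bilinear_map_right[OF assms(1) module_hom_mem[OF assms(2)]] assms(3)]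
  by blast

lemma bilinear_map_swap: "bilinear_map K M N P f \<Longrightarrow> bilinear_map K N M P (\<lambda>x y. f y x)"
  by (simp add: bilinear_map_def)

lemma bilinear_map_minus_fun:
  "\<lbrakk>module K P; bilinear_map K M N P f; bilinear_map K M N P g\<rbrakk> \<Longrightarrow>
    bilinear_map K M N P (\<lambda>x y. f x y \<ominus>\<^bsub>P\<^esub> g x y)"
  by (simp add: bilinear_map_def module_hom_minus_fun)

section \<open>Universal property of the tensor product\<close>

context
  fixes K :: "('k, 'm) ring_scheme" and M :: "('k, 'a, 'n) module_scheme"
    and N :: "('k, 'b, 'p) module_scheme"
  assumes M: "module K M" and N: "module K N"
begin

interpretation M: module K M by (rule M)
interpretation N: module K N by (rule N)
interpretation F: module K "free_space K (carrier M \<times> carrier N)"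
  by (rule M.R.module_free_space)

lemma free_gen_pair_closed:
  "\<lbrakk>x \<in> carrier M; y \<in> carrier N\<rbrakk> \<Longrightarrow> free_gen K (x, y) \<in> carrier (free_space K (carrier M \<times> carrier N))"
  by (simp add: M.R.free_gen_closed)

lemma bilinear_relations_closed:
  "bilinear_relations K M N \<subseteq> carrier (free_space K (carrier M \<times> carrier N))"
  unfolding bilinear_relations_def Let_def
  by (intro Un_least subsetI; elim CollectE exE conjE; hypsubst)
    (intro F.M.minus_closed F.M.a_closed F.smult_closed free_gen_pair_closed M.M.a_closed
      N.M.a_closed M.smult_closed N.smult_closed; assumption)+

lemma submodule_tensor_null:
  "submodule K (tensor_null K M N) (free_space K (carrier M \<times> carrier N))"
  unfolding tensor_null_def by (rule F.span_is_submodule) (rule bilinear_relations_closed)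

interpretation W: submodule K "tensor_null K M N" "free_space K (carrier M \<times> carrier N)"
  by (rule submodule_tensor_null)

lemma module_tensor: "module K (tensor K M N)"
  unfolding tensor_def by (rule W.module_quotient_space)

lemmas tensor_add_coset = W.quotient_space_add[folded tensor_def]
lemmas tensor_smult_coset = W.quotient_space_smult[folded tensor_def]

lemma tensor_cases:
  assumes "t \<in> carrier (tensor K M N)"
  obtains \<phi> where "\<phi> \<in> carrier (free_space K (carrier M \<times> carrier N))"
    and "t = tensor_null K M N +>\<^bsub>free_space K (carrier M \<times> carrier N)\<^esub> \<phi>"
  using assms unfolding tensor_def by (rule W.quotient_space_cases)

lemma tensor_null_bilinear_relations: "\<phi> \<in> bilinear_relations K M N \<Longrightarrow> \<phi> \<in> tensor_null K M N"
  unfolding tensor_null_def using F.in_own_span[OF bilinear_relations_closed] by blast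

text \<open>The four families of relations are exactly the differences that bilinearity requires to
  vanish, and elements with difference in the null submodule have the same coset.\<close>

lemma bilinear_map_pure_tensor: "bilinear_map K M N (tensor K M N) (pure_tensor K M N)"
proof -
  note closed = free_gen_pair_closed W.quotient_space_closed
  have rel: "\<phi> \<ominus>\<^bsub>free_space K (carrier M \<times> carrier N)\<^esub> \<psi> \<in> bilinear_relations K M N \<Longrightarrow>
      \<phi> \<in> carrier (free_space K (carrier M \<times> carrier N)) \<Longrightarrow>
      \<psi> \<in> carrier (free_space K (carrier M \<times> carrier N)) \<Longrightarrow>
      tensor_null K M N +>\<^bsub>free_space K (carrier M \<times> carrier N)\<^esub> \<phi> =
      tensor_null K M N +>\<^bsub>free_space K (carrier M \<times> carrier N)\<^esub> \<psi>" for \<phi> \<psi>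
    by (intro W.coset_eqI tensor_null_bilinear_relations)
  have 1: "pure_tensor K M N x y \<in> carrier (tensor K M N)" if "x \<in> carrier M" "y \<in> carrier N" for x y
    using that by (simp add: pure_tensor_def tensor_def closed)
  have 2: "pure_tensor K M N (x \<oplus>\<^bsub>M\<^esub> x') y =
      pure_tensor K M N x y \<oplus>\<^bsub>tensor K M N\<^esub> pure_tensor K M N x' y"
    if "x \<in> carrier M" "x' \<in> carrier M" "y \<in> carrier N" for x x' y
    unfolding pure_tensor_def tensor_def
      W.quotient_space_add[OF free_gen_pair_closed[OF that(1,3)] free_gen_pair_closed[OF that(2,3)]]
    using that
    by (intro rel F.M.a_closed closed M.M.a_closed)
      (auto simp: bilinear_relations_def Let_def simp del: free_space_simps)
  have 3: "pure_tensor K M N x (y \<oplus>\<^bsub>N\<^esub> y') =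
      pure_tensor K M N x y \<oplus>\<^bsub>tensor K M N\<^esub> pure_tensor K M N x y'"
    if "x \<in> carrier M" "y \<in> carrier N" "y' \<in> carrier N" for x y y'
    unfolding pure_tensor_def tensor_def
      W.quotient_space_add[OF free_gen_pair_closed[OF that(1,2)] free_gen_pair_closed[OF that(1,3)]]
    using that
    by (intro rel F.M.a_closed closed N.M.a_closed)
      (auto simp: bilinear_relations_def Let_def simp del: free_space_simps)
  have 4: "pure_tensor K M N (c \<odot>\<^bsub>M\<^esub> x) y = c \<odot>\<^bsub>tensor K M N\<^esub> pure_tensor K M N x y"
    if "c \<in> carrier K" "x \<in> carrier M" "y \<in> carrier N" for c x y
    unfolding pure_tensor_def tensor_def
      W.quotient_space_smult[OF that(1) closed(1)[OF that(2,3)]]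
    using that
    by (intro rel F.smult_closed closed M.smult_closed)
      (auto simp: bilinear_relations_def Let_def simp del: free_space_simps)
  have 5: "pure_tensor K M N x (c \<odot>\<^bsub>N\<^esub> y) = c \<odot>\<^bsub>tensor K M N\<^esub> pure_tensor K M N x y"
    if "c \<in> carrier K" "x \<in> carrier M" "y \<in> carrier N" for c x y
    unfolding pure_tensor_def tensor_def
      W.quotient_space_smult[OF that(1) closed(1)[OF that(2,3)]]
    using that
    by (intro rel F.smult_closed closed N.smult_closed)
      (auto simp: bilinear_relations_def Let_def simp del: free_space_simps)
  show ?thesis
    using 1 2 3 4 5 by (simp add: bilinear_map_def module_hom_def)
qed

lemmas pure_tensor_closed = bilinear_map_closed[OF bilinear_map_pure_tensor]

text \<open>The linear extension of a bilinear \<open>f\<close> vanishes on the null submodule and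
  is therefore constant on cosets. This removes the choice from \<open>tensor_lift\<close>: any
  representative may be used.\<close>

lemma tensor_lift_coset:
  assumes P: "module K P" and f: "bilinear_map K M N P f"
    and \<phi>: "\<phi> \<in> carrier (free_space K (carrier M \<times> carrier N))"
  shows "tensor_lift K M N P f (tensor_null K M N +>\<^bsub>free_space K (carrier M \<times> carrier N)\<^esub> \<phi>)
    = free_eval K P (\<lambda>p. f (fst p) (snd p)) \<phi>"
proof -
  interpret P: module K P by (rule P)
  let ?F = "free_space K (carrier M \<times> carrier N)"
  let ?f = "\<lambda>p. f (fst p) (snd p)"
  let ?E = "free_eval K P ?f"
  have fc: "?f \<in> carrier M \<times> carrier N \<rightarrow> carrier P"
    using bilinear_map_closed[OF f] by auto
  interpret E: mod_hom K ?F P ?E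
    by (intro mod_homI P.free_eval_hom fc F.module_axioms P.module_axioms)
  have gen: "?E (free_gen K (x, y)) = f x y" if "x \<in> carrier M" "y \<in> carrier N" for x y
    using P.free_eval_gen[of "(x, y)", OF _ fc] that by simp
  note f_left = bilinear_map_left[OF f] and f_right = bilinear_map_right[OF f]
  note f_simps = module_hom_add[OF f_left] module_hom_smult[OF f_left]
    module_hom_add[OF f_right] module_hom_smult[OF f_right] bilinear_map_closed[OF f]
  \<comment> \<open>Each family of relations is killed by the matching clause of bilinearity of
    \<open>f\<close>; the kernel is a submodule, so it then contains the whole span.\<close>
  have "bilinear_relations K M N \<subseteq> E.ker"
    unfolding E.ker_def bilinear_relations_def Let_def
    by (intro Un_least subsetI; elim CollectE exE conjE; hypsubst)
      (simp_all add: free_gen_pair_closed gen f_simps P.M.r_neg a_minus_def[of P] del: free_space_simps)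
  then have ker: "tensor_null K M N \<subseteq> E.ker"
    unfolding tensor_null_def by (intro F.span_is_subset E.ker_is_submodule)
  interpret S: abelian_subgroup "tensor_null K M N" ?F
    by (rule submodule_imp_abelian_subgroup) (rule submodule_tensor_null)
  \<comment> \<open>This is the representative chosen inside \<open>tensor_lift\<close>; all that is
    known of it is that it lies in the coset of \<open>\<phi>\<close>.\<close>
  define \<psi> where "\<psi> = (SOME \<psi>. \<psi> \<in> tensor_null K M N +>\<^bsub>?F\<^esub> \<phi>)"
  have "\<psi> \<in> tensor_null K M N +>\<^bsub>?F\<^esub> \<phi>"
    unfolding \<psi>_def using S.a_rcos_self[OF \<phi>] by (rule someI[where P = "\<lambda>\<psi>. \<psi> \<in> _"])
  then have \<psi>: "\<psi> \<in> carrier ?F" and "\<psi> \<ominus>\<^bsub>?F\<^esub> \<phi> \<in> tensor_null K M N"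
    using S.a_elemrcos_carrier S.a_rcos_module_imp \<phi> unfolding a_minus_def by blast+
  with ker have "?E (\<psi> \<ominus>\<^bsub>?F\<^esub> \<phi>) = \<zero>\<^bsub>P\<^esub>"
    by (auto simp: E.ker_def)
  then have "?E \<psi> \<ominus>\<^bsub>P\<^esub> ?E \<phi> = \<zero>\<^bsub>P\<^esub>"
    using \<psi> \<phi> by simp
  then have "?E \<psi> = ?E \<phi>"
    using E.f_im[OF \<psi>] E.f_im[OF \<phi>] by simp
  then show ?thesis
    by (simp add: tensor_lift_def \<psi>_def[symmetric] free_eval_def Let_def)
qed

text \<open>On a coset the lift is \<open>free_eval\<close> at any representative, and the
  operations of the tensor product act on representatives, so linearity descends from the free
  module.\<close>

lemma tensor_lift_hom:
  assumes "module K P" "bilinear_map K M N P f"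
  shows "tensor_lift K M N P f \<in> module_hom K (tensor K M N) P"
proof -
  interpret P: module K P by fact
  have "(\<lambda>p. f (fst p) (snd p)) \<in> carrier M \<times> carrier N \<rightarrow> carrier P"
    using bilinear_map_closed[OF assms(2)] by auto
  note E = P.free_eval_hom[OF this]
  show ?thesis
    unfolding module_hom_def
    by (auto elim!: tensor_cases simp: tensor_lift_coset[OF assms] module_hom_mem[OF E]
        tensor_add_coset tensor_smult_coset F.M.a_closed F.smult_closed module_hom_add[OF E] module_hom_smult[OF E]
        simp del: free_space_simps)
qed

lemma tensor_lift_pure:
  assumes "module K P" "bilinear_map K M N P f" "x \<in> carrier M" "y \<in> carrier N"
  shows "tensor_lift K M N P f (pure_tensor K M N x y) = f x y"
proof -
  interpret P: module K P by fact
  have "(\<lambda>p. f (fst p) (snd p)) \<in> carrier M \<times> carrier N \<rightarrow> carrier P"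
    using bilinear_map_closed[OF assms(2)] by auto
  from P.free_eval_gen[of "(x, y)", OF _ this] show ?thesis
    using assms by (simp add: pure_tensor_def tensor_lift_coset free_gen_pair_closed)
qed

text \<open>Composed with the quotient map, both sides become linear maps on the free module, where
  agreement on generators suffices. Most identities below are reduced to pure tensors in this
  way.\<close>

lemma tensor_hom_eqI:
  assumes P: "module K P"
    and f: "f \<in> module_hom K (tensor K M N) P" and g: "g \<in> module_hom K (tensor K M N) P"
    and eq: "\<And>x y. \<lbrakk>x \<in> carrier M; y \<in> carrier N\<rbrakk> \<Longrightarrow>
      f (pure_tensor K M N x y) = g (pure_tensor K M N x y)"
    and t: "t \<in> carrier (tensor K M N)"
  shows "f t = g t"
proof -
  let ?F = "free_space K (carrier M \<times> carrier N)"
  let ?q = "\<lambda>\<phi>. tensor_null K M N +>\<^bsub>?F\<^esub> \<phi>"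
  have q: "?q \<in> module_hom K ?F (tensor K M N)"
    unfolding tensor_def by (rule W.quotient_map_hom)
  interpret f: mod_hom K ?F P "\<lambda>\<phi>. f (?q \<phi>)"
    by (intro mod_homI module_hom_comp[OF f q] F.module_axioms P)
  interpret g: mod_hom K ?F P "\<lambda>\<phi>. g (?q \<phi>)"
    by (intro mod_homI module_hom_comp[OF g q] F.module_axioms P)
  obtain \<phi> where \<phi>: "\<phi> \<in> carrier ?F" and t_eq: "t = ?q \<phi>"
    using t by (rule tensor_cases)
  from \<phi> have "f (?q \<phi>) = g (?q \<phi>)"
  proof (induction rule: M.R.free_space_induct)
    case zero
    show ?case
      using trans[OF f.f0_is_0 g.f0_is_0[symmetric]] .
  next
    case (add c p \<psi>)
    have e: "free_gen K p \<in> carrier ?F"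
      using add.hyps by (intro M.R.free_gen_closed)
    \<comment> \<open>The class of a generator is by definition a pure tensor.\<close>
    have "f (?q (free_gen K p)) = g (?q (free_gen K p))"
      using add.hyps eq[of "fst p" "snd p"] by (auto simp: pure_tensor_def)
    then show ?case
      using add.hyps add.IH e
      by (simp add: f.f_add g.f_add f.f_smult g.f_smult del: free_space_simps)
  qed
  with t_eq show ?thesis by simp
qed

text \<open>For fixed parameters both sides of each linearity equation are linear in
  \<open>t\<close>, and on pure tensors they agree by linearity of \<open>f\<close> in
  \<open>z\<close>. Nested lifts need this to be bilinear.\<close>

lemma tensor_lift_parameter_hom:
  assumes Z: "module K Z" and P: "module K P"
    and f: "\<And>z. z \<in> carrier Z \<Longrightarrow> bilinear_map K M N P (f z)"
    and hom: "\<And>x y. \<lbrakk>x \<in> carrier M; y \<in> carrier N\<rbrakk> \<Longrightarrow> (\<lambda>z. f z x y) \<in> module_hom K Z P"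
    and t: "t \<in> carrier (tensor K M N)"
  shows "(\<lambda>z. tensor_lift K M N P (f z) t) \<in> module_hom K Z P"
proof -
  interpret Z: module K Z by (rule Z)
  note lift = tensor_lift_hom[OF P f]
  have "tensor_lift K M N P (f (z \<oplus>\<^bsub>Z\<^esub> z')) t =
      tensor_lift K M N P (f z) t \<oplus>\<^bsub>P\<^esub> tensor_lift K M N P (f z') t"
    if "z \<in> carrier Z" "z' \<in> carrier Z" for z z'
    using P _ _ _ t
    by (rule tensor_hom_eqI[where g = "\<lambda>t. tensor_lift K M N P (f z) t \<oplus>\<^bsub>P\<^esub> tensor_lift K M N P (f z') t"])
      (simp_all add: that lift module_hom_add_fun[OF P] tensor_lift_pure[OF P f] module_hom_add[OF hom])
  moreover have "tensor_lift K M N P (f (c \<odot>\<^bsub>Z\<^esub> z)) t = c \<odot>\<^bsub>P\<^esub> tensor_lift K M N P (f z) t"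
    if "c \<in> carrier K" "z \<in> carrier Z" for c z
    using P _ _ _ t
    by (rule tensor_hom_eqI[where g = "\<lambda>t. c \<odot>\<^bsub>P\<^esub> tensor_lift K M N P (f z) t"])
      (simp_all add: that lift module_hom_smult_fun[OF P] tensor_lift_pure[OF P f] module_hom_smult[OF hom])
  moreover have "tensor_lift K M N P (f z) t \<in> carrier P" if "z \<in> carrier Z" for z
    using module_hom_mem[OF lift[OF that] t] .
  ultimately show ?thesis
    by (simp add: module_hom_def)
qed

end

section \<open>Induced maps on tensor products and their values on pure tensors\<close>

lemma bilinear_map_pure_tensor_comp:
  "\<lbrakk>module K M'; module K N'; f \<in> module_hom K M M'; g \<in> module_hom K N N'\<rbrakk> \<Longrightarrow>
    bilinear_map K M N (tensor K M' N') (\<lambda>x y. pure_tensor K M' N' (f x) (g y))"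
  by (rule bilinear_map_comp[OF bilinear_map_pure_tensor])

lemma pure_tensor_hom:
  assumes "module K M" "module K N"
  shows "x \<in> carrier M \<Longrightarrow> pure_tensor K M N x \<in> module_hom K N (tensor K M N)"
    and "y \<in> carrier N \<Longrightarrow> (\<lambda>x. pure_tensor K M N x y) \<in> module_hom K M (tensor K M N)"
  using bilinear_map_pure_tensor[OF assms] by (auto simp: bilinear_map_def)

lemma tensor_map_pure:
  assumes "module K M" "module K N" "module K M'" "module K N'"
    and "f \<in> module_hom K M M'" "g \<in> module_hom K N N'" "x \<in> carrier M" "y \<in> carrier N"
  shows "tensor_map K M N M' N' f g (pure_tensor K M N x y) = pure_tensor K M' N' (f x) (g y)"
  unfolding tensor_map_def using assms
  by (subst tensor_lift_pure) (simp_all add: module_tensor bilinear_map_pure_tensor_comp)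

lemma twist_bilinear:
  "module K A \<Longrightarrow> bilinear_map K A A (tensor K A A) (\<lambda>x y. pure_tensor K A A y x)"
  by (rule bilinear_map_swap[OF bilinear_map_pure_tensor])

lemma twist_hom: "module K A \<Longrightarrow> twist K A \<in> module_hom K (tensor K A A) (tensor K A A)"
  unfolding twist_def by (intro tensor_lift_hom module_tensor twist_bilinear)

lemma twist_pure:
  "\<lbrakk>module K A; x \<in> carrier A; y \<in> carrier A\<rbrakk> \<Longrightarrow>
    twist K A (pure_tensor K A A x y) = pure_tensor K A A y x"
  unfolding twist_def by (intro tensor_lift_pure module_tensor twist_bilinear)

lemma assoc_right_pure:
  assumes A: "module K A" and "x \<in> carrier A" "y \<in> carrier A" "z \<in> carrier A"
  shows "assoc_right K A (pure_tensor K (tensor K A A) A (pure_tensor K A A x y) z) =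
    pure_tensor K A (tensor K A A) x (pure_tensor K A A y z)"
proof -
  note T = module_tensor[OF A A]
  note P = module_tensor[OF A T]
  let ?f = "\<lambda>z x y. pure_tensor K A (tensor K A A) x (pure_tensor K A A y z)"
  have inner: "bilinear_map K A A (tensor K A (tensor K A A)) (?f z)" if "z \<in> carrier A" for z
    using that A T by (intro bilinear_map_pure_tensor_comp module_hom_id pure_tensor_hom)
  have par: "(\<lambda>z. ?f z x y) \<in> module_hom K A (tensor K A (tensor K A A))"
    if "x \<in> carrier A" "y \<in> carrier A" for x y
    by (rule module_hom_comp[OF pure_tensor_hom(1)[OF A T that(1)] pure_tensor_hom(1)[OF A A that(2)]])
  \<comment> \<open>Linearity in \<open>s\<close> is linearity of the inner lift; linearity in
    \<open>z\<close> is its linear dependence on a parameter.\<close>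
  have "bilinear_map K (tensor K A A) A (tensor K A (tensor K A A))
      (\<lambda>s z. tensor_lift K A A (tensor K A (tensor K A A)) (?f z) s)"
    unfolding bilinear_map_def
    by (intro conjI ballI tensor_lift_hom[OF A A P inner] tensor_lift_parameter_hom[OF A A A P inner par])
  then show ?thesis
    unfolding assoc_right_def using assms
    by (simp add: tensor_lift_pure[OF T A P] pure_tensor_closed tensor_lift_pure[OF A A P inner])
qed

section \<open>The balanceator\<close>

context eps_hom_bialgebra
begin

abbreviation T where "T \<equiv> tensor K A A"

abbreviation pure (infixl "\<star>" 75) where "x \<star> y \<equiv> pure_tensor K A A x y"

abbreviation prod (infixl "\<bullet>" 77) where "x \<bullet> y \<equiv> \<mu> (x \<star> y)"

lemma module_A: "module K A"
  by (rule module_axioms)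

lemmas module_T = module_tensor[OF module_A module_A]

interpretation T: module K T
  by (rule module_T)

lemma mu_hom: "\<mu> \<in> module_hom K T A"
  using mu_linear by (simp add: linear_map_def mod_hom_def mod_hom_axioms_def)

lemma alpha_hom: "\<alpha> \<in> module_hom K A A"
  using alpha_linear by (simp add: linear_map_def mod_hom_def mod_hom_axioms_def)

lemmas alpha_closed = module_hom_mem[OF alpha_hom]

lemmas pure_closed = pure_tensor_closed[OF module_A module_A]

lemma prod_closed: "\<lbrakk>x \<in> carrier A; y \<in> carrier A\<rbrakk> \<Longrightarrow> x \<bullet> y \<in> carrier A"
  by (intro module_hom_mem[OF mu_hom] pure_closed)

lemma prod_hom:
  "x \<in> carrier A \<Longrightarrow> (\<lambda>y. x \<bullet> y) \<in> module_hom K A A"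
  "y \<in> carrier A \<Longrightarrow> (\<lambda>x. x \<bullet> y) \<in> module_hom K A A"
  by (rule module_hom_comp[OF mu_hom], rule pure_tensor_hom[OF module_A module_A], assumption)+

lemma alpha_prod: "\<lbrakk>x \<in> carrier A; y \<in> carrier A\<rbrakk> \<Longrightarrow> \<alpha> (x \<bullet> y) = \<alpha> x \<bullet> \<alpha> y"
  by (simp add: alpha_mu pure_closed tensor_map_pure module_A alpha_hom)

text \<open>This is \<open>hom_associative\<close> at the pure tensor of \<open>x \<star> y\<close>
  and \<open>z\<close>, with both sides evaluated.\<close>

lemma prod_hom_assoc:
  assumes "x \<in> carrier A" "y \<in> carrier A" "z \<in> carrier A"
  shows "\<alpha> x \<bullet> (y \<bullet> z) = (x \<bullet> y) \<bullet> \<alpha> z"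
  using hom_associative[OF pure_tensor_closed[OF module_T module_A pure_closed[OF assms(1,2)] assms(3)]] assms
  by (simp add: assoc_right_pure module_A module_T tensor_map_pure pure_closed mu_hom alpha_hom)

section \<open>The two brackets as linear maps on the tensor square\<close>

lemma star_bracket_bilinear:
  assumes "a \<in> carrier A"
  shows "bilinear_map K A A T (\<lambda>u v. (a \<bullet> u) \<star> \<alpha> v \<ominus>\<^bsub>T\<^esub> \<alpha> u \<star> (v \<bullet> a))"
  by (intro bilinear_map_minus_fun bilinear_map_pure_tensor_comp module_T module_A alpha_hom prod_hom assms)

lemma star_bracket_hom: "a \<in> carrier A \<Longrightarrow> star_bracket K A \<mu> \<alpha> a \<in> module_hom K T T"
  unfolding star_bracket_def
  by (intro tensor_lift_hom star_bracket_bilinear module_T module_A)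

lemma star_bracket_pure:
  "\<lbrakk>a \<in> carrier A; u \<in> carrier A; v \<in> carrier A\<rbrakk> \<Longrightarrow>
    star_bracket K A \<mu> \<alpha> a (u \<star> v) = (a \<bullet> u) \<star> \<alpha> v \<ominus>\<^bsub>T\<^esub> \<alpha> u \<star> (v \<bullet> a)"
  unfolding star_bracket_def
  by (rule tensor_lift_pure[OF module_A module_A module_T star_bracket_bilinear])

text \<open>Through this identity linearity and evaluation need to be proved for only one of the two
  brackets.\<close>

lemma bullet_bracket_eq: "bullet_bracket K A \<mu> \<alpha> a = star_bracket K A \<mu> \<alpha> (\<alpha> a)"
  by (simp add: bullet_bracket_def star_bracket_def)

text \<open>Stated for every \<open>s\<close>, with \<open>twist K A s\<close> kept on the right: in
  this form both sides are linear in \<open>s\<close> and can be tested on pure tensors, whereas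
  anti-symmetry is a property of the whole tensor and not of its summands.\<close>

lemma bullet_bracket_twist_star_bracket:
  assumes x: "x \<in> carrier A" and y: "y \<in> carrier A" and s: "s \<in> carrier T"
  shows "bullet_bracket K A \<mu> \<alpha> x (twist K A (star_bracket K A \<mu> \<alpha> y s)) =
    twist K A (bullet_bracket K A \<mu> \<alpha> y (twist K A (star_bracket K A \<mu> \<alpha> x (twist K A s))))"
proof -
  note tw = twist_hom[OF module_A]
  interpret tw: mod_hom K T T "twist K A"
    by (intro mod_homI module_T tw)
  have star: "mod_hom K T T (star_bracket K A \<mu> \<alpha> a)" if "a \<in> carrier A" for a
    by (intro mod_homI module_T star_bracket_hom that)
  show ?thesis
    unfolding bullet_bracket_eq
  proof (rule tensor_hom_eqI[OF module_A module_A module_T _ _ _ s,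
        where f = "\<lambda>s. star_bracket K A \<mu> \<alpha> (\<alpha> x) (twist K A (star_bracket K A \<mu> \<alpha> y s))"])
    show "(\<lambda>s. star_bracket K A \<mu> \<alpha> (\<alpha> x) (twist K A (star_bracket K A \<mu> \<alpha> y s))) \<in> module_hom K T T"
      using star_bracket_hom[OF alpha_closed[OF x]] module_hom_comp[OF tw star_bracket_hom[OF y]]
      by (rule module_hom_comp)
    show "(\<lambda>s. twist K A (star_bracket K A \<mu> \<alpha> (\<alpha> y) (twist K A (star_bracket K A \<mu> \<alpha> x (twist K A s)))))
        \<in> module_hom K T T"
      using tw module_hom_comp[OF star_bracket_hom[OF alpha_closed[OF y]]
          module_hom_comp[OF tw module_hom_comp[OF star_bracket_hom[OF x] tw]]]
      by (rule module_hom_comp)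
  next
    fix u v assume u: "u \<in> carrier A" and v: "v \<in> carrier A"
    note closed = x y u v alpha_closed prod_closed pure_closed
    note eval = closed twist_pure[OF module_A] star_bracket_pure mod_hom.f_minus[OF star] tw.f_minus
    have L: "star_bracket K A \<mu> \<alpha> (\<alpha> x) (twist K A (star_bracket K A \<mu> \<alpha> y (u \<star> v))) =
        ((\<alpha> x \<bullet> \<alpha> v) \<star> \<alpha> (y \<bullet> u) \<ominus>\<^bsub>T\<^esub> \<alpha> (\<alpha> v) \<star> ((y \<bullet> u) \<bullet> \<alpha> x)) \<ominus>\<^bsub>T\<^esub>
        ((\<alpha> x \<bullet> (v \<bullet> y)) \<star> \<alpha> (\<alpha> u) \<ominus>\<^bsub>T\<^esub> \<alpha> (v \<bullet> y) \<star> (\<alpha> u \<bullet> \<alpha> x))"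
      by (simp add: eval)
    have R: "twist K A (star_bracket K A \<mu> \<alpha> (\<alpha> y) (twist K A (star_bracket K A \<mu> \<alpha> x (twist K A (u \<star> v))))) =
        (\<alpha> (x \<bullet> v) \<star> (\<alpha> y \<bullet> \<alpha> u) \<ominus>\<^bsub>T\<^esub> ((x \<bullet> v) \<bullet> \<alpha> y) \<star> \<alpha> (\<alpha> u)) \<ominus>\<^bsub>T\<^esub>
        (\<alpha> (\<alpha> v) \<star> (\<alpha> y \<bullet> (u \<bullet> x)) \<ominus>\<^bsub>T\<^esub> (\<alpha> v \<bullet> \<alpha> y) \<star> \<alpha> (u \<bullet> x))"
      by (simp add: eval)
    \<comment> \<open>The outer terms of \<open>L\<close> and \<open>R\<close> agree in order, by
      multiplicativity of \<open>\<alpha>\<close>. The two middle terms agree crosswise, by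
      Hom-associativity, and so have to be exchanged first.\<close>
    have swap: "(p \<ominus>\<^bsub>T\<^esub> q) \<ominus>\<^bsub>T\<^esub> (r \<ominus>\<^bsub>T\<^esub> s) = (p \<ominus>\<^bsub>T\<^esub> r) \<ominus>\<^bsub>T\<^esub> (q \<ominus>\<^bsub>T\<^esub> s)"
      if "p \<in> carrier T" "q \<in> carrier T" "r \<in> carrier T" "s \<in> carrier T" for p q r s
      using that by (simp add: a_minus_def T.M.minus_add T.M.a_ac)
    show "star_bracket K A \<mu> \<alpha> (\<alpha> x) (twist K A (star_bracket K A \<mu> \<alpha> y (u \<star> v))) =
        twist K A (star_bracket K A \<mu> \<alpha> (\<alpha> y) (twist K A (star_bracket K A \<mu> \<alpha> x (twist K A (u \<star> v)))))"
      unfolding L R by (subst swap) (simp_all add: closed alpha_prod prod_hom_assoc)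
  qed
qed

text \<open>A map that vanishes on all pairs is trivially bilinear, so its lift is linear; being
  zero on pure tensors, the lift is zero. Bilinearity of the balanceator thus follows from the
  vanishing itself.\<close>

lemma balanceator_eq_zero:
  assumes zero: "\<And>x y. \<lbrakk>x \<in> carrier A; y \<in> carrier A\<rbrakk> \<Longrightarrow>
      bullet_bracket K A \<mu> \<alpha> x (twist K A (\<Delta> y)) \<oplus>\<^bsub>T\<^esub>
      twist K A (bullet_bracket K A \<mu> \<alpha> y (twist K A (\<Delta> x))) = \<zero>\<^bsub>T\<^esub>"
    and t: "t \<in> carrier T"
  shows "balanceator K A \<mu> \<Delta> \<alpha> t = \<zero>\<^bsub>T\<^esub>"
proof -
  let ?B = "\<lambda>x y. bullet_bracket K A \<mu> \<alpha> x (twist K A (\<Delta> y)) \<oplus>\<^bsub>T\<^esub>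
      twist K A (bullet_bracket K A \<mu> \<alpha> y (twist K A (\<Delta> x)))"
  have B: "bilinear_map K A A T ?B"
    unfolding bilinear_map_def module_hom_def using zero by simp
  have "balanceator K A \<mu> \<Delta> \<alpha> \<in> module_hom K T T"
    unfolding balanceator_def by (rule tensor_lift_hom[OF module_A module_A module_T B])
  moreover have "(\<lambda>t. \<zero>\<^bsub>T\<^esub>) \<in> module_hom K T T"
    by (simp add: module_hom_def)
  ultimately show ?thesis
    by (rule tensor_hom_eqI[OF module_A module_A module_T _ _ _ t])
      (simp add: balanceator_def tensor_lift_pure[OF module_A module_A module_T B] zero)
qed

end

theorem lemma6p13:
  fixes K :: "('k, 'm) ring_scheme" and A :: "('k, 'a, 'n) module_scheme"
    and \<mu> :: "('a \<times> 'a \<Rightarrow> 'k) set \<Rightarrow> 'a" and \<Delta> :: "'a \<Rightarrow> ('a \<times> 'a \<Rightarrow> 'k) set"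
    and \<alpha> :: "'a \<Rightarrow> 'a" and r :: "('a \<times> 'a \<Rightarrow> 'k) set"
  assumes char_0: "\<And>n::nat. n > 0 \<Longrightarrow> [n] \<cdot>\<^bsub>K\<^esub> \<one>\<^bsub>K\<^esub> \<noteq> \<zero>\<^bsub>K\<^esub>"
    and "coboundary_eps_hom_bialgebra K A \<mu> \<Delta> \<alpha> r"
    and "antisymmetric K A r"
  shows "\<forall>t \<in> carrier (tensor K A A). balanceator K A \<mu> \<Delta> \<alpha> t = \<zero>\<^bsub>tensor K A A\<^esub>"
proof
  fix t assume t: "t \<in> carrier (tensor K A A)"
  interpret coboundary_eps_hom_bialgebra K A \<mu> \<Delta> \<alpha> r by fact
  interpret T: module K "tensor K A A"
    by (rule module_T)
  interpret tw: mod_hom K "tensor K A A" "tensor K A A" "twist K A"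
    by (intro mod_homI module_T twist_hom module_A)
  have star: "mod_hom K (tensor K A A) (tensor K A A) (star_bracket K A \<mu> \<alpha> a)" if "a \<in> carrier A" for a
    by (intro mod_homI module_T star_bracket_hom that)
  have twist_r: "twist K A r = \<ominus>\<^bsub>tensor K A A\<^esub> r"
    using assms(3) by (simp add: antisymmetric_def)
  show "balanceator K A \<mu> \<Delta> \<alpha> t = \<zero>\<^bsub>tensor K A A\<^esub>"
  proof (rule balanceator_eq_zero[OF _ t])
    fix x y assume x: "x \<in> carrier A" and y: "y \<in> carrier A"
    note closed = x y r_closed alpha_closed module_hom_mem[OF star_bracket_hom] tw.f_im
    have "bullet_bracket K A \<mu> \<alpha> x (twist K A (\<Delta> y)) =
        twist K A (bullet_bracket K A \<mu> \<alpha> y (twist K A (star_bracket K A \<mu> \<alpha> x (twist K A r))))"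
      using x y by (simp add: Delta_coboundary bullet_bracket_twist_star_bracket r_closed)
    \<comment> \<open>Anti-symmetry enters here: the sign in \<open>twist_r\<close> passes outwards
      through both brackets and both remaining twists, and the bracket of \<open>x\<close> with
      \<open>r\<close> that is left is \<open>\<Delta> x\<close>.\<close>
    also have "\<dots> = \<ominus>\<^bsub>tensor K A A\<^esub> twist K A (bullet_bracket K A \<mu> \<alpha> y (twist K A (\<Delta> x)))"
      by (simp add: twist_r bullet_bracket_eq Delta_coboundary mod_hom.f_neg[OF star] closed)
    finally show "bullet_bracket K A \<mu> \<alpha> x (twist K A (\<Delta> y)) \<oplus>\<^bsub>tensor K A A\<^esub>
        twist K A (bullet_bracket K A \<mu> \<alpha> y (twist K A (\<Delta> x))) = \<zero>\<^bsub>tensor K A A\<^esub>"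
      by (simp add: T.M.l_neg Delta_coboundary bullet_bracket_eq closed)
  qed
qed

end
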